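(* Let $h:[0,\infty[\,\to[0,\infty[$ be a one-dimensional aggregation function, i.e. $h(0)=0$ and $h$ is increasing. The following conditions are equivalent: (a) There exists a real $x>0$ for which $h^*(x)=\infty$. (b) $h^*(x)=\infty$ for every real $x>0$. (c) $\limsup_{t\to 0^+}\frac{h(t)}{t}=\infty$. (d) $\sup\{\frac{h(t)}{t}\mid t\in\,]0,x]\}=\infty$ for some real $x>0$. Similarly, the following statements are equivalent: (a') There exists a real $x>0$ for which $h_*(x)=0$. (b') $h_*(x)=0$ for every real $x\ge 0$. (c') $\liminf_{t\to 0^+}\frac{h(t)}{t}=0$. (d') $\inf\{\frac{h(t)}{t}\mid t\in\,]0,x]\}=0$ for some real $x>0$.
   Context: $[0,\infty[$ denotes the finite non-negative reals and $]0,x]$ the half-open interval excluding $0$. "Increasing" means non-decreasing. For $x\in[0,\infty[$, the subadditive and superadditive transformations of $h$ are $$h_*(x)=\inf\Big\{\sum_{i=1}^k h(y_i)\ \Big|\ \sum_{i=1}^k y_i\ge x\Big\},\qquad h^*(x)=\sup\Big\{\sum_{j=1}^{\ell} h(y_j)\ \Big|\ \sum_{j=1}^{\ell} y_j\le x\Big\},$$ where $k,\ell$ range over all positive integers and the $y_i,y_j$ range over $[0,\infty[$; the values of $h_*,h^*$ lie in $[0,\infty]$. *)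

theory Defs
  imports "HOL-Analysis.Analysis"
begin

text \<open>
  A function from $[0,\infty[$ to $[0,\infty[$ is a function on type \<^typ>\<open>real\<close> of which only
  the restriction to \<open>{0..}\<close> matters: its values at negative arguments are unconstrained, and
  no definition below evaluates it there.
\<close>

definition aggregation_function :: "(real \<Rightarrow> real) \<Rightarrow> bool" where
  "aggregation_function h \<longleftrightarrow> h \<in> {0..} \<rightarrow> {0..} \<and> h 0 = 0 \<and> mono_on {0..} h"

text \<open>
  The infimum and supremum are taken in \<^typ>\<open>ereal\<close>. They are used for \<open>x \<ge> 0\<close> only;
  there both sets are non-empty and consist of non-negative elements.
\<close>

definition subadditive_transform :: "(real \<Rightarrow> real) \<Rightarrow> real \<Rightarrow> ereal" where
  "subadditive_transform h x =
     Inf {ereal (\<Sum>i=1..k. h (y i)) | (k :: nat) (y :: nat \<Rightarrow> real).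
            k \<ge> 1 \<and> (\<forall>i\<in>{1..k}. y i \<ge> 0) \<and> (\<Sum>i=1..k. y i) \<ge> x}"

definition superadditive_transform :: "(real \<Rightarrow> real) \<Rightarrow> real \<Rightarrow> ereal" where
  "superadditive_transform h x =
     Sup {ereal (\<Sum>j=1..l. h (y j)) | (l :: nat) (y :: nat \<Rightarrow> real).
            l \<ge> 1 \<and> (\<forall>j\<in>{1..l}. y j \<ge> 0) \<and> (\<Sum>j=1..l. y j) \<le> x}"

end

theory Submission
  imports Defs
begin

text \<open>
  Monotonicity confines the degenerate behaviour of \<open>h t / t\<close> to the origin: on \<open>{\<delta>..x}\<close> the
  ratio lies between \<open>h \<delta> / x\<close> and \<open>h x / \<delta>\<close>. If the ratio is extreme at some small \<open>t\<close>, then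
  summing about \<open>x / t\<close> copies of \<open>h t\<close> makes the transform at \<open>x\<close> extreme. Conversely, a linear
  bound on \<open>h\<close> over \<open>{0..x}\<close> passes to sums and bounds the transform at \<open>x\<close>.
\<close>

section \<open>Extreme limits, suprema and infima expressed by real inequalities\<close>

lemma ereal_Limsup_eq_PInfty_iff:
  fixes f :: "'a \<Rightarrow> real"
  shows "Limsup F (\<lambda>t. ereal (f t)) = \<infinity> \<longleftrightarrow> (\<forall>M. \<exists>\<^sub>F t in F. M < f t)"
proof
  assume inf: "Limsup F (\<lambda>t. ereal (f t)) = \<infinity>"
  show "\<forall>M. \<exists>\<^sub>F t in F. M < f t"
  proof (intro allI notI, unfold frequently_def, rule notI)
    fix M assume "\<forall>\<^sub>F t in F. \<not> M < f t"
    then have "Limsup F (\<lambda>t. ereal (f t)) \<le> ereal M"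
      by (intro Limsup_bounded) (auto elim: eventually_mono)
    with inf show False by simp
  qed
next
  assume fr: "\<forall>M. \<exists>\<^sub>F t in F. M < f t"
  show "Limsup F (\<lambda>t. ereal (f t)) = \<infinity>"
  proof (rule ccontr)
    assume "Limsup F (\<lambda>t. ereal (f t)) \<noteq> \<infinity>"
    \<comment> \<open>The naturals are cofinal below infinity, so any other value, even minus
      infinity, lies strictly below some real.\<close>
    then obtain M :: real where "Limsup F (\<lambda>t. ereal (f t)) < ereal M"
      by (auto simp: less_PInf_Ex_of_nat)
    then have "\<forall>\<^sub>F t in F. \<not> M < f t"
      by (auto dest!: Limsup_lessD elim: eventually_mono)
    with fr show False by (simp add: frequently_def)
  qed
qed

text \<open>Eventual nonnegativity gives the lower bound 0, so only a positive Liminf has to be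
  excluded; density supplies a real \<open>e\<close> strictly between 0 and it, which
  \<open>f\<close> eventually exceeds.\<close>

lemma ereal_Liminf_eq_0_iff:
  fixes f :: "'a \<Rightarrow> real"
  assumes nonneg: "\<forall>\<^sub>F t in F. 0 \<le> f t"
  shows "Liminf F (\<lambda>t. ereal (f t)) = 0 \<longleftrightarrow> (\<forall>e>0. \<exists>\<^sub>F t in F. f t < e)"
proof
  assume zero: "Liminf F (\<lambda>t. ereal (f t)) = 0"
  show "\<forall>e>0. \<exists>\<^sub>F t in F. f t < e"
  proof (intro allI impI, unfold frequently_def, rule notI)
    fix e :: real assume "0 < e" and "\<forall>\<^sub>F t in F. \<not> f t < e"
    then have "ereal e \<le> Liminf F (\<lambda>t. ereal (f t))"
      by (intro Liminf_bounded) (auto elim: eventually_mono)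
    with zero \<open>0 < e\<close> show False by simp
  qed
next
  assume fr: "\<forall>e>0. \<exists>\<^sub>F t in F. f t < e"
  have "0 \<le> Liminf F (\<lambda>t. ereal (f t))"
    using nonneg by (intro Liminf_bounded) (auto elim: eventually_mono)
  moreover have "\<not> 0 < Liminf F (\<lambda>t. ereal (f t))"
  proof
    assume "0 < Liminf F (\<lambda>t. ereal (f t))"
    then obtain e :: real where "0 < e" "ereal e < Liminf F (\<lambda>t. ereal (f t))"
      using ereal_dense2[of 0] by auto
    then have "\<forall>\<^sub>F t in F. \<not> f t < e"
      by (auto dest!: less_LiminfD elim: eventually_mono)
    with fr \<open>0 < e\<close> show False by (simp add: frequently_def)
  qed
  ultimately show "Liminf F (\<lambda>t. ereal (f t)) = 0" by auto
qed

lemma ereal_SUP_eq_PInfty_iff: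
  fixes f :: "'a \<Rightarrow> real"
  shows "(SUP t\<in>A. ereal (f t)) = \<infinity> \<longleftrightarrow> (\<forall>M. \<exists>t\<in>A. M < f t)"
proof
  assume "(SUP t\<in>A. ereal (f t)) = \<infinity>"
  then show "\<forall>M. \<exists>t\<in>A. M < f t"
    using less_SUP_iff[of "ereal _" "\<lambda>t. ereal (f t)" A] by auto
next
  assume "\<forall>M. \<exists>t\<in>A. M < f t"
  then have "\<exists>t\<in>A. ereal (real n) \<le> ereal (f t)" for n
    by (auto intro: less_imp_le)
  then show "(SUP t\<in>A. ereal (f t)) = \<infinity>"
    by (intro SUP_PInfty) auto
qed

lemma ereal_INF_eq_0_iff:
  fixes f :: "'a \<Rightarrow> real"
  assumes nonneg: "\<And>t. t \<in> A \<Longrightarrow> 0 \<le> f t"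
  shows "(INF t\<in>A. ereal (f t)) = 0 \<longleftrightarrow> (\<forall>e>0. \<exists>t\<in>A. f t < e)"
proof
  assume "(INF t\<in>A. ereal (f t)) = 0"
  then show "\<forall>e>0. \<exists>t\<in>A. f t < e"
    using INF_less_iff[of "\<lambda>t. ereal (f t)" A "ereal _"] by auto
next
  assume small: "\<forall>e>0. \<exists>t\<in>A. f t < e"
  have "0 \<le> (INF t\<in>A. ereal (f t))"
    using nonneg by (intro INF_greatest) auto
  moreover have "(INF t\<in>A. ereal (f t)) \<le> 0"
  proof (rule ereal_le_epsilon2)
    fix e :: real assume "0 < e"
    with small obtain t where "t \<in> A" "f t < e" by blast
    then show "(INF t\<in>A. ereal (f t)) \<le> 0 + ereal e"
      by (intro INF_lower2[of t]) auto
  qed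
  ultimately show "(INF t\<in>A. ereal (f t)) = 0" by auto
qed

lemma frequently_at_right_iff:
  fixes a :: real
  shows "(\<exists>\<^sub>F t in at_right a. P t) \<longleftrightarrow> (\<forall>b>a. \<exists>t>a. t < b \<and> P t)"
  unfolding frequently_def eventually_at_right_field by blast

section \<open>Bounds on the transforms: constant families and linear comparison\<close>

lemma superadditive_transform_upper:
  assumes "k \<ge> 1" "0 \<le> t" "real k * t \<le> x"
  shows "ereal (real k * h t) \<le> superadditive_transform h x"
  unfolding superadditive_transform_def
  using assms by (intro Sup_upper CollectI exI[of _ k] exI[of _ "\<lambda>_. t"]) auto

lemma subadditive_transform_lower:
  assumes "k \<ge> 1" "0 \<le> t" "x \<le> real k * t"
  shows "subadditive_transform h x \<le> ereal (real k * h t)"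
  unfolding subadditive_transform_def
  using assms by (intro Inf_lower CollectI exI[of _ k] exI[of _ "\<lambda>_. t"]) auto

text \<open>Nonnegative terms with sum at most \<open>x\<close> are each at most \<open>x\<close>,
  so a linear bound on \<open>{0..x}\<close> alone applies to every term.\<close>

lemma superadditive_transform_le_linear:
  assumes "0 \<le> C" and lin: "\<And>t. 0 \<le> t \<Longrightarrow> t \<le> x \<Longrightarrow> h t \<le> C * t"
  shows "superadditive_transform h x \<le> ereal (C * x)"
  unfolding superadditive_transform_def
proof (rule Sup_least, clarify)
  fix l :: nat and y :: "nat \<Rightarrow> real"
  assume pos: "\<forall>j\<in>{1..l}. y j \<ge> 0" and le: "(\<Sum>j=1..l. y j) \<le> x"
  have "h (y j) \<le> C * y j" if "j \<in> {1..l}" for j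
  proof -
    have "y j \<le> (\<Sum>j=1..l. y j)"
      using pos that by (intro member_le_sum) auto
    with le pos that show ?thesis by (intro lin) auto
  qed
  then have "(\<Sum>j=1..l. h (y j)) \<le> C * (\<Sum>j=1..l. y j)"
    unfolding sum_distrib_left by (rule sum_mono)
  also have "\<dots> \<le> C * x"
    using le \<open>0 \<le> C\<close> by (rule mult_left_mono)
  finally show "ereal (\<Sum>j=1..l. h (y j)) \<le> ereal (C * x)" by simp
qed

locale aggregation =
  fixes h :: "real \<Rightarrow> real"
  assumes agg: "aggregation_function h"
begin

lemma zero: "h 0 = 0"
  using agg by (simp add: aggregation_function_def)

lemma nonneg: "0 \<le> t \<Longrightarrow> 0 \<le> h t"
  using agg by (auto simp: aggregation_function_def)

lemma mono: "0 \<le> s \<Longrightarrow> s \<le> t \<Longrightarrow> h s \<le> h t"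
  using agg by (auto simp: aggregation_function_def mono_on_def)

lemma subadditive_transform_nonneg: "0 \<le> subadditive_transform h x"
  unfolding subadditive_transform_def
  by (rule Inf_greatest) (auto intro!: sum_nonneg nonneg)

text \<open>A sum with some \<open>y i > x\<close> escapes the linear bound, but there \<open>h (y i) \<ge> h x\<close> suffices.\<close>

lemma linear_le_subadditive_transform:
  assumes "0 \<le> x" "0 \<le> c" and lin: "\<And>t. 0 \<le> t \<Longrightarrow> t \<le> x \<Longrightarrow> c * t \<le> h t"
  shows "ereal (c * x) \<le> subadditive_transform h x"
  unfolding subadditive_transform_def
proof (rule Inf_greatest, clarify)
  fix k :: nat and y :: "nat \<Rightarrow> real"
  assume pos: "\<forall>i\<in>{1..k}. y i \<ge> 0" and ge: "x \<le> (\<Sum>i=1..k. y i)"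
  have "c * x \<le> (\<Sum>i=1..k. h (y i))"
  proof (cases "\<exists>i\<in>{1..k}. x < y i")
    case True
    then obtain i where i: "i \<in> {1..k}" "x < y i" by blast
    have "c * x \<le> h x" using \<open>0 \<le> x\<close> by (rule lin) simp
    also have "\<dots> \<le> h (y i)" using i \<open>0 \<le> x\<close> by (intro mono) auto
    also have "\<dots> \<le> (\<Sum>i=1..k. h (y i))"
      using i pos by (intro member_le_sum nonneg) auto
    finally show ?thesis .
  next
    case False
    have "c * x \<le> c * (\<Sum>i=1..k. y i)"
      using ge \<open>0 \<le> c\<close> by (rule mult_left_mono)
    also have "\<dots> \<le> (\<Sum>i=1..k. h (y i))"
      unfolding sum_distrib_left using False pos by (intro sum_mono lin) (auto simp: not_less)
    finally show ?thesis .
  qed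
  then show "ereal (c * x) \<le> ereal (\<Sum>i=1..k. h (y i))" by simp
qed

section \<open>Superadditive transform and unbounded ratio\<close>

lemma SUP_ratio_infinite_if_superadditive_transform_infinite:
  assumes "0 < x" and inf: "superadditive_transform h x = \<infinity>"
  shows "(SUP t\<in>{0<..x}. ereal (h t / t)) = \<infinity>"
  unfolding ereal_SUP_eq_PInfty_iff
proof (rule allI, rule ccontr)
  fix M assume "\<not> (\<exists>t\<in>{0<..x}. M < h t / t)"
  then have le: "h t \<le> M * t" if "0 < t" "t \<le> x" for t
    using that by (force simp: not_less divide_le_eq)
  \<comment> \<open>The linear comparison asks for a nonnegative slope and includes
    \<open>t = 0\<close>; hence the absolute value and the appeal to \<open>h 0 = 0\<close>.\<close>
  have "h t \<le> \<bar>M\<bar> * t" if "0 \<le> t" "t \<le> x" for t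
  proof (cases "t = 0")
    case False
    with that have "h t \<le> M * t" by (intro le) auto
    also have "\<dots> \<le> \<bar>M\<bar> * t" using that by (intro mult_right_mono) auto
    finally show ?thesis .
  qed (simp add: zero)
  then have "superadditive_transform h x \<le> ereal (\<bar>M\<bar> * x)"
    by (intro superadditive_transform_le_linear) auto
  with inf show False by simp
qed

lemma Limsup_ratio_infinite_if_SUP_ratio_infinite:
  assumes "0 < x" and inf: "(SUP t\<in>{0<..x}. ereal (h t / t)) = \<infinity>"
  shows "Limsup (at_right 0) (\<lambda>t. ereal (h t / t)) = \<infinity>"
  unfolding ereal_Limsup_eq_PInfty_iff frequently_at_right_iff
proof (intro allI impI)
  fix M d :: real assume "0 < d"
  \<comment> \<open>Exceeding \<open>M\<close> is the goal; exceeding \<open>h x / d\<close> forces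
    \<open>t < d\<close>, as the ratio is at most \<open>h x / d\<close> on
    \<open>{d..x}\<close>.\<close>
  have "\<exists>t\<in>{0<..x}. max M (h x / d) < h t / t"
    using inf unfolding ereal_SUP_eq_PInfty_iff by blast
  then obtain t where t: "0 < t" "t \<le> x" "max M (h x / d) < h t / t" by auto
  have "t < d"
  proof (rule ccontr)
    assume "\<not> t < d"
    then have "h t / t \<le> h x / d"
      using t \<open>0 < d\<close> by (intro frac_le mono nonneg) auto
    with t show False by simp
  qed
  with t show "\<exists>t>0. t < d \<and> M < h t / t" by auto
qed

text \<open>Rounding \<open>x / t\<close> down keeps \<open>n\<close> copies of \<open>t\<close>
  within \<open>x\<close>, and for \<open>t < x\<close> they still fill at least half of it. The
  factor 2 in the threshold \<open>2 * B / x\<close> pays for the lost half.\<close>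

lemma superadditive_transform_infinite_if_Limsup_ratio_infinite:
  assumes "0 < x" and inf: "Limsup (at_right 0) (\<lambda>t. ereal (h t / t)) = \<infinity>"
  shows "superadditive_transform h x = \<infinity>"
proof -
  have "ereal B \<le> superadditive_transform h x" if "0 \<le> B" for B
  proof -
    obtain t where t: "0 < t" "t < x" "2 * B / x < h t / t"
      using inf \<open>0 < x\<close> unfolding ereal_Limsup_eq_PInfty_iff frequently_at_right_iff by blast
    define n where "n = nat \<lfloor>x / t\<rfloor>"
    have "1 \<le> x / t" using t by simp
    then have n1: "n \<ge> 1" and nle: "real n \<le> x / t" and ngt: "x / t < real n + 1"
      unfolding n_def by linarith+
    have nx: "real n * t \<le> x" using nle t by (simp add: field_simps)
    \<comment> \<open>Here \<open>1 \<le> n\<close> turns the rounding error of 1 into a factor: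
      \<open>n + 1 \<le> 2 * n\<close>.\<close>
    have "x / t \<le> 2 * real n" using ngt n1 by linarith
    then have "x \<le> 2 * (real n * t)" using t by (simp add: field_simps)
    then have "2 * B / x * (x / 2) \<le> 2 * B / x * (real n * t)"
      using \<open>0 \<le> B\<close> \<open>0 < x\<close> by (intro mult_left_mono) auto
    also have "\<dots> \<le> h t / t * (real n * t)"
      using t by (intro mult_right_mono) auto
    also have "\<dots> = real n * h t" using t by simp
    finally have "B \<le> real n * h t" using \<open>0 < x\<close> by simp
    also have "ereal (real n * h t) \<le> superadditive_transform h x"
      using n1 nx t by (intro superadditive_transform_upper) auto
    finally show ?thesis by simp
  qed
  \<comment> \<open>A negative bound \<open>B\<close> is replaced by \<open>max B 0\<close>.\<close>
  then show ?thesis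
    by (intro ereal_top) (meson ereal_less_eq(3) max.cobounded1 max.cobounded2 order_trans)
qed

section \<open>Subadditive transform and vanishing ratio\<close>

lemma INF_ratio_zero_if_subadditive_transform_zero:
  assumes "0 < x" and eq0: "subadditive_transform h x = 0"
  shows "(INF t\<in>{0<..x}. ereal (h t / t)) = 0"
proof -
  have "\<exists>t\<in>{0<..x}. h t / t < e" if "0 < e" for e
  proof (rule ccontr)
    assume "\<not> (\<exists>t\<in>{0<..x}. h t / t < e)"
    then have "e * t \<le> h t" if "0 < t" "t \<le> x" for t
      using that by (force simp: not_less le_divide_eq)
    then have "e * t \<le> h t" if "0 \<le> t" "t \<le> x" for t
      using that zero by (cases "t = 0") auto
    then have "ereal (e * x) \<le> subadditive_transform h x"
      using \<open>0 < x\<close> \<open>0 < e\<close> by (intro linear_le_subadditive_transform) auto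
    moreover have "0 < e * x" using \<open>0 < x\<close> \<open>0 < e\<close> by simp
    ultimately show False using eq0 by simp
  qed
  then show ?thesis by (subst ereal_INF_eq_0_iff) (auto intro!: divide_nonneg_pos nonneg)
qed

text \<open>The ratio is nonnegative to the right of 0, so \<open>ereal_Liminf_eq_0_iff\<close>
  applies. This form serves both to establish and to exploit a zero Liminf.\<close>

lemma Liminf_ratio_zero_iff:
  "Liminf (at_right 0) (\<lambda>t. ereal (h t / t)) = 0 \<longleftrightarrow> (\<forall>e>0. \<forall>d>0. \<exists>t>0. t < d \<and> h t / t < e)"
proof -
  have "\<forall>\<^sub>F t in at_right 0. 0 \<le> h t / t"
    unfolding eventually_at_right_field by (auto intro!: exI[of _ 1] divide_nonneg_pos nonneg)
  then show ?thesis by (simp add: ereal_Liminf_eq_0_iff frequently_at_right_iff)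
qed

lemma Liminf_ratio_zero_if_INF_ratio_zero:
  assumes "0 < x" and eq0: "(INF t\<in>{0<..x}. ereal (h t / t)) = 0"
  shows "Liminf (at_right 0) (\<lambda>t. ereal (h t / t)) = 0"
  unfolding Liminf_ratio_zero_iff
proof (intro allI impI)
  fix e d :: real assume "0 < e" "0 < d"
  have small: "\<exists>t\<in>{0<..x}. h t / t < c" if "0 < c" for c
    using eq0 that by (subst (asm) ereal_INF_eq_0_iff) (auto intro!: divide_nonneg_pos nonneg)
  \<comment> \<open>A point strictly below \<open>d\<close>, since \<open>s\<close> itself may have
    to be the witness: the lower bound \<open>h s / x\<close> for the ratio on \<open>{s..x}\<close>
    excludes nothing when \<open>h s = 0\<close>, but then the ratio at \<open>s\<close> is
    0.\<close>
  define s where "s = d / 2"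
  have s: "0 < s" "s < d" using \<open>0 < d\<close> by (auto simp: s_def)
  show "\<exists>t>0. t < d \<and> h t / t < e"
  proof (cases "h s = 0")
    case True
    with s \<open>0 < e\<close> show ?thesis by (intro exI[of _ s]) auto
  next
    case False
    with s nonneg[of s] have "0 < h s" by simp
    \<comment> \<open>A ratio below \<open>h s / x\<close> cannot occur on \<open>{s..x}\<close>,
      which forces \<open>t < s\<close>.\<close>
    then obtain t where t: "0 < t" "t \<le> x" "h t / t < min e (h s / x)"
      using small[of "min e (h s / x)"] \<open>0 < e\<close> \<open>0 < x\<close> by auto
    have "t < s"
    proof (rule ccontr)
      assume "\<not> t < s"
      then have "h s / x \<le> h t / t"
        using t s by (intro frac_le mono nonneg) auto
      with t show False by simp
    qed
    with t s show ?thesis by (intro exI[of _ t]) auto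
  qed
qed

text \<open>Rounding \<open>x / t\<close> up makes \<open>n\<close> copies of \<open>t\<close> reach
  \<open>x\<close>, and for \<open>t < x\<close> the overshoot stays within \<open>2 * x\<close>;
  this explains the threshold \<open>e / (2 * x)\<close>. As it divides by \<open>x\<close>, the
  case \<open>x = 0\<close> is separate, settled by the single summand \<open>h 0\<close>.\<close>

lemma subadditive_transform_zero_if_Liminf_ratio_zero:
  assumes "0 \<le> x" and eq0: "Liminf (at_right 0) (\<lambda>t. ereal (h t / t)) = 0"
  shows "subadditive_transform h x = 0"
proof (cases "x = 0")
  case True
  then have "subadditive_transform h x \<le> 0"
    using subadditive_transform_lower[of 1 0 x h] zero by (simp add: zero_ereal_def)
  with subadditive_transform_nonneg show ?thesis by (simp add: order_antisym)
next
  case False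
  with assms have "0 < x" by simp
  have "subadditive_transform h x \<le> 0"
  proof (rule ereal_le_epsilon2)
    fix e :: real assume "0 < e"
    obtain t where t: "0 < t" "t < x" "h t / t < e / (2 * x)"
      using eq0 \<open>0 < x\<close> \<open>0 < e\<close> unfolding Liminf_ratio_zero_iff
      by (metis divide_pos_pos mult_pos_pos zero_less_numeral)
    define n where "n = nat \<lceil>x / t\<rceil>"
    have "1 < x / t" using t by simp
    then have n1: "n \<ge> 1" and nge: "x / t \<le> real n" and nlt: "real n < x / t + 1"
      unfolding n_def by linarith+
    have xn: "x \<le> real n * t" using nge t by (simp add: field_simps)
    \<comment> \<open>The rounding error of 1 is absorbed by \<open>1 < x / t\<close>.\<close>
    have "real n \<le> 2 * (x / t)" using nlt \<open>1 < x / t\<close> by linarith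
    then have n2: "real n * t \<le> 2 * x" using t by (simp add: field_simps)
    have "subadditive_transform h x \<le> ereal (real n * h t)"
      using n1 xn t by (intro subadditive_transform_lower) auto
    also have "real n * h t = h t / t * (real n * t)" using t by simp
    also have "\<dots> \<le> e / (2 * x) * (2 * x)"
      using t n2 \<open>0 < e\<close> \<open>0 < x\<close> by (intro mult_mono[OF _ n2]) auto
    also have "\<dots> = e" using \<open>0 < x\<close> by simp
    finally show "subadditive_transform h x \<le> 0 + ereal e" by simp
  qed
  with subadditive_transform_nonneg show ?thesis by (simp add: order_antisym)
qed

end

section \<open>Assembly of the two cycles of implications\<close>

theorem theorem2:
  fixes h :: "real \<Rightarrow> real"
  assumes "aggregation_function h"
  shows "((\<exists>x>0. superadditive_transform h x = \<infinity>)
            \<longleftrightarrow> (\<forall>x>0. superadditive_transform h x = \<infinity>))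
       \<and> ((\<forall>x>0. superadditive_transform h x = \<infinity>)
            \<longleftrightarrow> Limsup (at_right 0) (\<lambda>t. ereal (h t / t)) = \<infinity>)
       \<and> (Limsup (at_right 0) (\<lambda>t. ereal (h t / t)) = \<infinity>
            \<longleftrightarrow> (\<exists>x>0. (SUP t\<in>{0<..x}. ereal (h t / t)) = \<infinity>))
       \<and> ((\<exists>x>0. subadditive_transform h x = 0)
            \<longleftrightarrow> (\<forall>x\<ge>0. subadditive_transform h x = 0))
       \<and> ((\<forall>x\<ge>0. subadditive_transform h x = 0)
            \<longleftrightarrow> Liminf (at_right 0) (\<lambda>t. ereal (h t / t)) = 0)
       \<and> (Liminf (at_right 0) (\<lambda>t. ereal (h t / t)) = 0
            \<longleftrightarrow> (\<exists>x>0. (INF t\<in>{0<..x}. ereal (h t / t)) = 0))"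
proof -
  interpret aggregation h by (unfold_locales) (rule assms)
  let ?S = "\<lambda>x. superadditive_transform h x = \<infinity>"
  let ?LS = "Limsup (at_right 0) (\<lambda>t. ereal (h t / t)) = \<infinity>"
  let ?US = "\<exists>x>0. (SUP t\<in>{0<..x}. ereal (h t / t)) = \<infinity>"
  have sup: "(\<exists>x>0. ?S x) \<longrightarrow> ?US" "?US \<longrightarrow> ?LS" "?LS \<longrightarrow> (\<forall>x>0. ?S x)"
    using SUP_ratio_infinite_if_superadditive_transform_infinite
      Limsup_ratio_infinite_if_SUP_ratio_infinite
      superadditive_transform_infinite_if_Limsup_ratio_infinite by blast+
  \<comment> \<open>Each cycle is closed by instantiating the universal condition at 1.\<close>
  have sup_ex: "(\<forall>x>0. ?S x) \<longrightarrow> (\<exists>x>0. ?S x)"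
    by (meson zero_less_one)
  let ?s = "\<lambda>x. subadditive_transform h x = 0"
  let ?LI = "Liminf (at_right 0) (\<lambda>t. ereal (h t / t)) = 0"
  let ?UI = "\<exists>x>0. (INF t\<in>{0<..x}. ereal (h t / t)) = 0"
  have inf: "(\<exists>x>0. ?s x) \<longrightarrow> ?UI" "?UI \<longrightarrow> ?LI" "?LI \<longrightarrow> (\<forall>x\<ge>0. ?s x)"
    using INF_ratio_zero_if_subadditive_transform_zero
      Liminf_ratio_zero_if_INF_ratio_zero
      subadditive_transform_zero_if_Liminf_ratio_zero by blast+
  have inf_ex: "(\<forall>x\<ge>0. ?s x) \<longrightarrow> (\<exists>x>0. ?s x)"
    by (meson zero_less_one zero_le_one)
  show ?thesis
    using sup sup_ex inf inf_ex by argo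
qed

end
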